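(* Let $\Gamma$ be a finite simplicial graph with non-empty vertex set $V(\Gamma)$, let $\{G_v\mid v\in V(\Gamma)\}$ be a collection of non-trivial groups, and let $G_\Gamma$ be the associated graph product. (i) If $\Gamma$ has a separating star, then $G_\Gamma$ is not semicomplete. (ii) Assume that $V(\Gamma)$ is not a star of a vertex, i.e. $st(v)\neq V(\Gamma)$ for every $v\in V(\Gamma)$. If $G_\Gamma$ is semicomplete, then all vertex groups $G_v$, $v\in V(\Gamma)$, are abelian.
   Context: Graphs are finite, without loops and multiple edges. For a graph $\Gamma$ with vertex set $V(\Gamma)$ and edge set $E(\Gamma)$ (a set of 2-element subsets of $V(\Gamma)$), and non-trivial groups $G_v$ ($v\in V(\Gamma)$), the graph product $G_\Gamma$ is the quotient of the free product $\ast_{v\in V(\Gamma)} G_v$ by the normal closure of all commutators $[g,h]$ with $g\in G_v$, $h\in G_w$, $\{v,w\}\in E(\Gamma)$. For $v\in V(\Gamma)$, the star of $v$ is $st(v)=\{v\}\cup\{w\in V(\Gamma)\mid \{v,w\}\in E(\Gamma)\}$. A graph $\Gamma$ has a separating star if there is a vertex $v\in V(\Gamma)$ such that the subgraph spanned by $V(\Gamma)-st(v)$ is disconnected, i.e. there are two vertices of $V(\Gamma)-st(v)$ not joined by a path in this induced subgraph (in particular, the empty graph is not disconnected). For a group $G$ let $G^{ab}=G/G'$ be its abelianization and $\Phi\colon \mathrm{Aut}(G)\to\mathrm{Aut}(G^{ab})$ the natural homomorphism induced by the abelianization map. Write $\mathrm{IA}(G)=\ker(\Phi)$; always $\mathrm{Inn}(G)\subseteq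 \mathrm{IA}(G)$. The group $G$ is called semicomplete if $\mathrm{IA}(G)=\mathrm{Inn}(G)$. *)

theory Defs
  imports "HOL-Algebra.Algebra"
begin

section \<open>Simple graphs\<close>

definition simple_graph :: "'v set \<Rightarrow> 'v set set \<Rightarrow> bool" where
  "simple_graph V E \<longleftrightarrow> finite V \<and> (\<forall>e\<in>E. e \<subseteq> V \<and> card e = 2)"

definition star :: "'v set \<Rightarrow> 'v set set \<Rightarrow> 'v \<Rightarrow> 'v set" where
  "star V E v = {v} \<union> {w \<in> V. {v, w} \<in> E}"

definition induced_edges :: "'v set set \<Rightarrow> 'v set \<Rightarrow> 'v set set" where
  "induced_edges E U = {e \<in> E. e \<subseteq> U}"

text \<open>A path is given by its list of successive vertices; a single vertex is a path of length 0.\<close>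

definition joined_by_path :: "'v set \<Rightarrow> 'v set set \<Rightarrow> 'v \<Rightarrow> 'v \<Rightarrow> bool" where
  "joined_by_path V E a b \<longleftrightarrow>
     (\<exists>p. p \<noteq> [] \<and> set p \<subseteq> V \<and> hd p = a \<and> last p = b \<and> successively (\<lambda>x y. {x, y} \<in> E) p)"

text \<open>The empty graph is not disconnected.\<close>

definition disconnected_graph :: "'v set \<Rightarrow> 'v set set \<Rightarrow> bool" where
  "disconnected_graph V E \<longleftrightarrow> (\<exists>a\<in>V. \<exists>b\<in>V. \<not> joined_by_path V E a b)"

definition has_separating_star :: "'v set \<Rightarrow> 'v set set \<Rightarrow> bool" where
  "has_separating_star V E \<longleftrightarrow>
     (\<exists>v\<in>V. disconnected_graph (V - star V E v) (induced_edges E (V - star V E v)))"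

section \<open>Free products and graph products\<close>

text \<open>
  The free product consists of the words in the disjoint union of the groups, modulo the
  congruence generated by deleting identity letters and by multiplying two adjacent letters
  from the same group.
\<close>

definition free_product_words :: "'v set \<Rightarrow> ('v \<Rightarrow> ('g, 'm) monoid_scheme) \<Rightarrow> ('v \<times> 'g) list set" where
  "free_product_words V G = lists (SIGMA v:V. carrier (G v))"

inductive_set free_product_rel ::
    "'v set \<Rightarrow> ('v \<Rightarrow> ('g, 'm) monoid_scheme) \<Rightarrow> (('v \<times> 'g) list \<times> ('v \<times> 'g) list) set"
  for V :: "'v set" and G :: "'v \<Rightarrow> ('g, 'm) monoid_scheme" where
  one: "\<lbrakk>v \<in> V; xs \<in> free_product_words V G; ys \<in> free_product_words V G\<rbrakk>
    \<Longrightarrow> (xs @ [(v, \<one>\<^bsub>G v\<^esub>)] @ ys, xs @ ys) \<in> free_product_rel V G"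
| mult: "\<lbrakk>v \<in> V; g \<in> carrier (G v); h \<in> carrier (G v);
      xs \<in> free_product_words V G; ys \<in> free_product_words V G\<rbrakk>
    \<Longrightarrow> (xs @ [(v, g), (v, h)] @ ys, xs @ [(v, g \<otimes>\<^bsub>G v\<^esub> h)] @ ys) \<in> free_product_rel V G"
| refl: "xs \<in> free_product_words V G \<Longrightarrow> (xs, xs) \<in> free_product_rel V G"
| sym: "(xs, ys) \<in> free_product_rel V G \<Longrightarrow> (ys, xs) \<in> free_product_rel V G"
| trans: "\<lbrakk>(xs, ys) \<in> free_product_rel V G; (ys, zs) \<in> free_product_rel V G\<rbrakk>
    \<Longrightarrow> (xs, zs) \<in> free_product_rel V G"

definition free_product ::
    "'v set \<Rightarrow> ('v \<Rightarrow> ('g, 'm) monoid_scheme) \<Rightarrow> ('v \<times> 'g) list set monoid" where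
  "free_product V G =
     \<lparr>carrier = free_product_words V G // free_product_rel V G,
      monoid.mult = \<lambda>A B. \<Union>a\<in>A. \<Union>b\<in>B. free_product_rel V G `` {a @ b},
      one = free_product_rel V G `` {[]}\<rparr>"

definition free_product_incl ::
    "'v set \<Rightarrow> ('v \<Rightarrow> ('g, 'm) monoid_scheme) \<Rightarrow> 'v \<Rightarrow> 'g \<Rightarrow> ('v \<times> 'g) list set" where
  "free_product_incl V G v g = free_product_rel V G `` {[(v, g)]}"

definition commutator :: "('a, 'm) monoid_scheme \<Rightarrow> 'a \<Rightarrow> 'a \<Rightarrow> 'a" where
  "commutator G x y = x \<otimes>\<^bsub>G\<^esub> y \<otimes>\<^bsub>G\<^esub> inv\<^bsub>G\<^esub> x \<otimes>\<^bsub>G\<^esub> inv\<^bsub>G\<^esub> y"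

definition normal_closure :: "('a, 'm) monoid_scheme \<Rightarrow> 'a set \<Rightarrow> 'a set" where
  "normal_closure G S = \<Inter>{N. N \<lhd> G \<and> S \<subseteq> N}"

definition graph_product ::
    "'v set \<Rightarrow> 'v set set \<Rightarrow> ('v \<Rightarrow> ('g, 'm) monoid_scheme) \<Rightarrow> ('v \<times> 'g) list set set monoid" where
  "graph_product V E G =
     free_product V G Mod
       normal_closure (free_product V G)
         {commutator (free_product V G) (free_product_incl V G v g) (free_product_incl V G w h)
           | v w g h. {v, w} \<in> E \<and> g \<in> carrier (G v) \<and> h \<in> carrier (G w)}"

section \<open>Semicomplete groups\<close>

definition abelianization :: "('a, 'm) monoid_scheme \<Rightarrow> 'a set monoid" where
  "abelianization G = G Mod derived G (carrier G)"

text \<open>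
  An automorphism \<open>f\<close> maps the coset of \<open>x\<close> modulo the derived subgroup onto the coset of
  \<open>f x\<close>, so the induced automorphism of the abelianization takes direct images of cosets.
\<close>

definition abelianization_map :: "('a, 'm) monoid_scheme \<Rightarrow> ('a \<Rightarrow> 'a) \<Rightarrow> 'a set \<Rightarrow> 'a set" where
  "abelianization_map G f = (\<lambda>C\<in>carrier (abelianization G). f ` C)"

definition IA :: "('a, 'm) monoid_scheme \<Rightarrow> ('a \<Rightarrow> 'a) set" where
  "IA G = kernel (AutoGroup G) (AutoGroup (abelianization G)) (abelianization_map G)"

definition Inn :: "('a, 'm) monoid_scheme \<Rightarrow> ('a \<Rightarrow> 'a) set" where
  "Inn G = (\<lambda>g. \<lambda>x\<in>carrier G. g \<otimes>\<^bsub>G\<^esub> x \<otimes>\<^bsub>G\<^esub> inv\<^bsub>G\<^esub> g) ` carrier G"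

definition semicomplete :: "('a, 'm) monoid_scheme \<Rightarrow> bool" where
  "semicomplete G \<longleftrightarrow> IA G = Inn G"

end

theory Submission
  imports Defs
begin

text \<open>
  Let \<open>g\<close> be an element of a vertex group at \<open>v\<close> and \<open>A\<close> a set of vertices whose neighbours outside
  \<open>A\<close> are adjacent to \<open>v\<close>.  Conjugating the vertex groups over \<open>A\<close> by \<open>g\<close> and fixing all the others
  defines an automorphism in \<open>IA\<close>.  Part (i) takes for \<open>A\<close> a component of the complement of a
  separating star, part (ii) takes \<open>A = {v}\<close>.  Suppose this automorphism is conjugation by \<open>x\<close>, and
  retract onto the free product of the vertex groups at \<open>v\<close> and at one vertex outside the star (ii),
  or at \<open>v\<close> and at one vertex in each of two components (i).  There the centralizer of a non-trivial
  element of a free factor lies in that factor, which forces the image of \<open>x\<close> to be trivial.  Hence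
  \<open>g\<close> commutes with a vertex group over \<open>A\<close>: impossible in (i), and in (ii) \<open>g\<close> is central in the
  vertex group at \<open>v\<close>.
\<close>

section \<open>Free products\<close>

text \<open>The letter map \<open>f\<close> is arbitrary because it is used twice: with
  homomorphisms into a target group for the universal property, and with \<open>letter_perm\<close>
  to turn reduced words into permutations.\<close>

primrec word_eval ::
    "('a, 'k) monoid_scheme \<Rightarrow> ('v \<Rightarrow> 'g \<Rightarrow> 'a) \<Rightarrow> ('v \<times> 'g) list \<Rightarrow> 'a" where
  "word_eval H f [] = \<one>\<^bsub>H\<^esub>"
| "word_eval H f (l # xs) = f (fst l) (snd l) \<otimes>\<^bsub>H\<^esub> word_eval H f xs"

section \<open>The free product of a family of groups and its universal property\<close>

locale group_family =
  fixes V :: "'v set" and G :: "'v \<Rightarrow> ('g, 'm) monoid_scheme"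
  assumes group_vertex: "v \<in> V \<Longrightarrow> group (G v)"
begin

abbreviation words :: "('v \<times> 'g) list set" where
  "words \<equiv> free_product_words V G"

abbreviation rel :: "(('v \<times> 'g) list \<times> ('v \<times> 'g) list) set" where
  "rel \<equiv> free_product_rel V G"

abbreviation word_class :: "('v \<times> 'g) list \<Rightarrow> ('v \<times> 'g) list set" where
  "word_class xs \<equiv> rel `` {xs}"

lemma words_simps [simp]:
  "[] \<in> words"
  "l # xs \<in> words \<longleftrightarrow> fst l \<in> V \<and> snd l \<in> carrier (G (fst l)) \<and> xs \<in> words"
  "xs @ ys \<in> words \<longleftrightarrow> xs \<in> words \<and> ys \<in> words"
  by (cases l; auto simp: free_product_words_def)+

lemma words_induct [consumes 1, case_names Nil Cons]:
  assumes "xs \<in> words" "P []"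
    and "\<And>v g xs. \<lbrakk>v \<in> V; g \<in> carrier (G v); xs \<in> words; P xs\<rbrakk> \<Longrightarrow> P ((v, g) # xs)"
  shows "P xs"
  using assms(1) by (induction xs) (use assms(2,3) in auto)

lemma rel_words: "(xs, ys) \<in> rel \<Longrightarrow> xs \<in> words \<and> ys \<in> words"
  by (induction rule: free_product_rel.induct)
    (auto simp: group.is_monoid[OF group_vertex] monoid.m_closed monoid.one_closed)

lemma equiv_rel: "equiv words rel"
  by (rule equivI)
    (auto simp: refl_on_def sym_def trans_def dest: rel_words intro: free_product_rel.intros)

lemma rel_append_left: "\<lbrakk>(xs, ys) \<in> rel; zs \<in> words\<rbrakk> \<Longrightarrow> (zs @ xs, zs @ ys) \<in> rel"
proof (induction rule: free_product_rel.induct)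
  case (one v xs ys)
  then show ?case using free_product_rel.one[of v V "zs @ xs" G ys] by simp
next
  case (mult v g h xs ys)
  then show ?case using free_product_rel.mult[of v V g G h "zs @ xs" ys] by simp
qed (auto intro: free_product_rel.intros(3-5))

lemma rel_append_right: "\<lbrakk>(xs, ys) \<in> rel; zs \<in> words\<rbrakk> \<Longrightarrow> (xs @ zs, ys @ zs) \<in> rel"
proof (induction rule: free_product_rel.induct)
  case (one v xs ys)
  then show ?case using free_product_rel.one[of v V xs G "ys @ zs"] by simp
next
  case (mult v g h xs ys)
  then show ?case using free_product_rel.mult[of v V g G h xs "ys @ zs"] by simp
qed (auto intro: free_product_rel.intros(3-5))

lemma rel_append: "\<lbrakk>(xs, xs') \<in> rel; (ys, ys') \<in> rel\<rbrakk> \<Longrightarrow> (xs @ ys, xs' @ ys') \<in> rel"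
  by (meson free_product_rel.trans rel_append_left rel_append_right rel_words)

lemma word_class_eqI: "(xs, ys) \<in> rel \<Longrightarrow> word_class xs = word_class ys"
  using equiv_class_eq[OF equiv_rel] .

lemma carrier_free_product: "carrier (free_product V G) = word_class ` words"
  by (auto simp: free_product_def quotient_def)

lemma one_free_product: "\<one>\<^bsub>free_product V G\<^esub> = word_class []"
  by (simp add: free_product_def)

text \<open>The union in the definition of the product runs over all pairs of representatives; it
  collapses to one class because concatenation respects the congruence.\<close>

lemma mult_free_product:
  assumes "xs \<in> words" "ys \<in> words"
  shows "word_class xs \<otimes>\<^bsub>free_product V G\<^esub> word_class ys = word_class (xs @ ys)"
proof -
  have "congruent2 rel rel (\<lambda>a b. word_class (a @ b))"
    by (rule congruent2I') (rule word_class_eqI, rule rel_append)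
  from UN_equiv_class2[OF equiv_rel equiv_rel this assms] show ?thesis
    by (simp add: free_product_def)
qed

text \<open>Invert the letters and reverse their order: the innermost pair multiplies to an identity
  letter, which is then deleted. Left inverses on representatives are all that \<open>groupI\<close>
  asks for.\<close>

lemma free_product_left_inverse:
  assumes "xs \<in> words"
  shows "\<exists>ys\<in>words. (ys @ xs, []) \<in> rel"
  using assms
proof (induction rule: words_induct)
  case (Cons v g xs)
  then obtain ys where ys: "ys \<in> words" "(ys @ xs, []) \<in> rel"
    by blast
  interpret group "G v"
    using Cons group_vertex by blast
  have "(ys @ [(v, inv\<^bsub>G v\<^esub> g), (v, g)] @ xs, ys @ [(v, inv\<^bsub>G v\<^esub> g \<otimes>\<^bsub>G v\<^esub> g)] @ xs) \<in> rel"
    using Cons ys by (intro free_product_rel.mult) auto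
  moreover have "(ys @ [(v, \<one>\<^bsub>G v\<^esub>)] @ xs, ys @ xs) \<in> rel"
    using Cons ys by (intro free_product_rel.one) auto
  ultimately have "(ys @ [(v, inv\<^bsub>G v\<^esub> g), (v, g)] @ xs, []) \<in> rel"
    using Cons ys by (metis free_product_rel.trans l_inv)
  then show ?case
    using ys Cons by (intro bexI[of _ "ys @ [(v, inv\<^bsub>G v\<^esub> g)]"]) auto
qed (use free_product_rel.refl[of "[]" V G] in \<open>auto intro!: bexI[of _ "[]"]\<close>)

lemma group_free_product: "group (free_product V G)"
proof (rule groupI)
  fix A assume "A \<in> carrier (free_product V G)"
  then obtain xs where xs: "xs \<in> words" "A = word_class xs"
    by (auto simp: carrier_free_product)
  then obtain ys where "ys \<in> words" "(ys @ xs, []) \<in> rel"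
    using free_product_left_inverse by blast
  then show "\<exists>B\<in>carrier (free_product V G). B \<otimes>\<^bsub>free_product V G\<^esub> A = \<one>\<^bsub>free_product V G\<^esub>"
    using xs by (intro bexI[of _ "word_class ys"])
      (simp_all add: carrier_free_product mult_free_product one_free_product word_class_eqI)
qed (auto simp: carrier_free_product mult_free_product one_free_product)

lemma free_product_incl_hom:
  assumes "v \<in> V"
  shows "free_product_incl V G v \<in> hom (G v) (free_product V G)"
proof (rule homI)
  fix g h assume gh: "g \<in> carrier (G v)" "h \<in> carrier (G v)"
  have "([] @ [(v, g), (v, h)] @ [], [] @ [(v, g \<otimes>\<^bsub>G v\<^esub> h)] @ []) \<in> rel"
    using gh assms by (intro free_product_rel.mult) auto
  then show "free_product_incl V G v (g \<otimes>\<^bsub>G v\<^esub> h)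
      = free_product_incl V G v g \<otimes>\<^bsub>free_product V G\<^esub> free_product_incl V G v h"
    using gh assms word_class_eqI by (simp add: free_product_incl_def mult_free_product)
qed (use assms in \<open>auto simp: free_product_incl_def carrier_free_product\<close>)

text \<open>Evaluation of words in \<open>H\<close> respects both generating relations: deleting an
  identity letter because each \<open>f v\<close> preserves the identity, merging two letters
  because it is multiplicative. So it descends to classes.\<close>

lemma free_product_universal:
  assumes "group H" and f: "\<And>v. v \<in> V \<Longrightarrow> f v \<in> hom (G v) H"
  obtains F where "F \<in> hom (free_product V G) H"
    "\<And>v g. \<lbrakk>v \<in> V; g \<in> carrier (G v)\<rbrakk> \<Longrightarrow> F (free_product_incl V G v g) = f v g"
proof -
  interpret H: group H by fact
  have cl: "f v g \<in> carrier H" if "v \<in> V" "g \<in> carrier (G v)" for v g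
    using f that by (auto simp: hom_def)
  have ev_closed: "word_eval H f xs \<in> carrier H" if "xs \<in> words" for xs
    using that by (induction rule: words_induct) (auto simp: cl)
  have ev_append: "word_eval H f (xs @ ys) = word_eval H f xs \<otimes>\<^bsub>H\<^esub> word_eval H f ys"
    if "xs \<in> words" "ys \<in> words" for xs ys
    using that by (induction rule: words_induct) (auto simp: cl ev_closed H.m_assoc)
  have one: "f v \<one>\<^bsub>G v\<^esub> = \<one>\<^bsub>H\<^esub>" if "v \<in> V" for v
    using hom_one[OF f] group_vertex that assms(1) by blast
  have ev_rel: "word_eval H f xs = word_eval H f ys" if "(xs, ys) \<in> rel" for xs ys
    using that
  proof (induction rule: free_product_rel.induct)
    case (one v xs ys)
    then show ?case
      using \<open>v \<in> V \<Longrightarrow> f v \<one>\<^bsub>G v\<^esub> = \<one>\<^bsub>H\<^esub>\<close> group.is_monoid[OF group_vertex, of v]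
      by (simp add: ev_append ev_closed monoid.one_closed)
  next
    case (mult v g h xs ys)
    then show ?case
      using group.is_monoid[OF group_vertex, of v] hom_mult[OF f, of v g h]
      by (simp add: ev_append ev_closed monoid.m_closed cl H.m_assoc)
  qed auto
  \<comment> \<open>Evaluation is constant on a class, so the image of the class is a singleton and
    no representative has to be chosen.\<close>
  define F where "F A = the_elem (word_eval H f ` A)" for A
  have F: "F (word_class xs) = word_eval H f xs" if "xs \<in> words" for xs
  proof -
    have "word_eval H f ` word_class xs = {word_eval H f xs}"
      using that ev_rel by (auto intro: free_product_rel.refl)
    then show ?thesis by (simp add: F_def)
  qed
  show thesis
  proof
    show "F \<in> hom (free_product V G) H"
      by (rule homI)
        (auto simp: carrier_free_product mult_free_product F ev_closed ev_append)
    show "F (free_product_incl V G v g) = f v g" if "v \<in> V" "g \<in> carrier (G v)" for v g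
      using that by (simp add: free_product_incl_def F cl)
  qed
qed

end

section \<open>Graph products\<close>

lemma (in group) normal_normal_closure:
  assumes "S \<subseteq> carrier G"
  shows "normal_closure G S \<lhd> G"
proof -
  have "subgroup (normal_closure G S) G"
    unfolding normal_closure_def
    using assms normal_self by (intro subgroups_Inter) (auto simp: normal_imp_subgroup)
  then show ?thesis
    by (auto simp: normal_inv_iff normal_closure_def)
qed

lemma (in group) cancel_left:
  assumes "x \<in> carrier G" "y \<in> carrier G"
  shows "x \<otimes> (inv x \<otimes> y) = y" "inv x \<otimes> (x \<otimes> y) = y"
  using assms by (simp_all flip: m_assoc)

lemma (in group) conj_eq_iff_commute:
  assumes "x \<in> carrier G" "y \<in> carrier G"
  shows "x \<otimes> y \<otimes> inv x = y \<longleftrightarrow> x \<otimes> y = y \<otimes> x"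
  using assms by (metis inv_solve_right m_closed)

lemma (in group) commutator_eq_one_iff:
  assumes "x \<in> carrier G" "y \<in> carrier G"
  shows "commutator G x y = \<one> \<longleftrightarrow> x \<otimes> y = y \<otimes> x"
  using assms unfolding commutator_def
  by (metis conj_eq_iff_commute inv_closed inv_equality inv_inv m_closed r_inv)

lemma (in group_hom) hom_commutator:
  "\<lbrakk>x \<in> carrier G; y \<in> carrier G\<rbrakk> \<Longrightarrow> h (commutator G x y) = commutator H (h x) (h y)"
  by (simp add: commutator_def)

section \<open>The graph product, its generators and its universal property\<close>

locale graph_of_groups = group_family V G
  for V :: "'v set" and G :: "'v \<Rightarrow> ('g, 'm) monoid_scheme" +
  fixes E :: "'v set set"
  assumes simple_graph: "simple_graph V E"
begin

abbreviation edge_commutators :: "('v \<times> 'g) list set set" where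
  "edge_commutators \<equiv>
    {commutator (free_product V G) (free_product_incl V G v g) (free_product_incl V G w h)
      | v w g h. {v, w} \<in> E \<and> g \<in> carrier (G v) \<and> h \<in> carrier (G w)}"

definition vertex_incl :: "'v \<Rightarrow> 'g \<Rightarrow> ('v \<times> 'g) list set set" where
  "vertex_incl v g =
    normal_closure (free_product V G) edge_commutators
      #>\<^bsub>free_product V G\<^esub> free_product_incl V G v g"

abbreviation "GP \<equiv> graph_product V E G"

sublocale FP: group "free_product V G"
  by (rule group_free_product)

lemma edgeD:
  assumes "{v, w} \<in> E"
  shows "v \<in> V" "w \<in> V" "v \<noteq> w"
proof -
  have "{v, w} \<subseteq> V" "card {v, w} = 2"
    using assms simple_graph unfolding simple_graph_def by blast+
  then show "v \<in> V" "w \<in> V" "v \<noteq> w"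
    by (auto simp: card_insert_if)
qed

lemma free_product_incl_closed:
  "\<lbrakk>v \<in> V; g \<in> carrier (G v)\<rbrakk> \<Longrightarrow> free_product_incl V G v g \<in> carrier (free_product V G)"
  using free_product_incl_hom by (auto simp: hom_def)

lemma edge_commutators_closed: "edge_commutators \<subseteq> carrier (free_product V G)"
  by (auto simp: commutator_def edgeD(1,2) free_product_incl_closed)

lemma normal_edge_closure:
  "normal_closure (free_product V G) edge_commutators \<lhd> free_product V G"
  by (rule FP.normal_normal_closure[OF edge_commutators_closed])

sublocale N: normal "normal_closure (free_product V G) edge_commutators" "free_product V G"
  by (rule normal_edge_closure)

lemma graph_product_eq:
  "GP = free_product V G Mod normal_closure (free_product V G) edge_commutators"
  by (simp add: graph_product_def)

sublocale GP: group "graph_product V E G"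
  unfolding graph_product_eq by (rule N.factorgroup_is_group)

lemma vertex_incl_hom:
  assumes "v \<in> V"
  shows "vertex_incl v \<in> hom (G v) GP"
proof -
  have "(\<lambda>x. normal_closure (free_product V G) edge_commutators #>\<^bsub>free_product V G\<^esub> x)
      \<circ> free_product_incl V G v \<in> hom (G v) GP"
    unfolding graph_product_eq
    using hom_compose[OF free_product_incl_hom[OF assms] N.r_coset_hom_Mod] .
  then show ?thesis
    by (simp add: vertex_incl_def[abs_def] comp_def)
qed

lemma vertex_incl_closed [simp]:
  "\<lbrakk>v \<in> V; g \<in> carrier (G v)\<rbrakk> \<Longrightarrow> vertex_incl v g \<in> carrier GP"
  using vertex_incl_hom by (auto simp: hom_def)

lemma vertex_incl_inv:
  "\<lbrakk>v \<in> V; g \<in> carrier (G v)\<rbrakk> \<Longrightarrow> vertex_incl v (inv\<^bsub>G v\<^esub> g) = inv\<^bsub>GP\<^esub> vertex_incl v g"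
  using group_hom.hom_inv[of "G v" GP "vertex_incl v" g] vertex_incl_hom group_vertex
  by (simp add: group_hom_def group_hom_axioms_def GP.is_group)

lemma vertex_incl_commute:
  assumes "{v, w} \<in> E" "g \<in> carrier (G v)" "h \<in> carrier (G w)"
  shows "vertex_incl v g \<otimes>\<^bsub>GP\<^esub> vertex_incl w h = vertex_incl w h \<otimes>\<^bsub>GP\<^esub> vertex_incl v g"
proof -
  let ?N = "normal_closure (free_product V G) edge_commutators"
  let ?c = "commutator (free_product V G) (free_product_incl V G v g) (free_product_incl V G w h)"
  interpret q: group_hom "free_product V G" GP "\<lambda>x. ?N #>\<^bsub>free_product V G\<^esub> x"
    using N.r_coset_hom_Mod unfolding graph_product_eq[symmetric]
    by (simp add: group_hom_def group_hom_axioms_def GP.is_group FP.is_group)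
  have vw: "v \<in> V" "w \<in> V"
    using edgeD assms(1) by auto
  have "?c \<in> edge_commutators"
    using assms by blast
  then have "?c \<in> ?N"
    unfolding normal_closure_def by blast
  then have "?N #>\<^bsub>free_product V G\<^esub> ?c = \<one>\<^bsub>GP\<^esub>"
    unfolding graph_product_eq by (simp add: FP.coset_join2 N.subset N.is_subgroup N.mem_carrier)
  moreover have "?N #>\<^bsub>free_product V G\<^esub> ?c = commutator GP (vertex_incl v g) (vertex_incl w h)"
    using q.hom_commutator[of "free_product_incl V G v g" "free_product_incl V G w h"]
      free_product_incl_closed vw assms by (simp add: vertex_incl_def)
  ultimately show ?thesis
    using GP.commutator_eq_one_iff vw assms by simp
qed

text \<open>The extension to the free product sends every edge commutator to the identity. Its
  kernel is normal, hence contains their normal closure, and the map factors through the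
  quotient.\<close>

lemma graph_product_universal:
  assumes "group H" and f: "\<And>v. v \<in> V \<Longrightarrow> f v \<in> hom (G v) H"
    and comm: "\<And>v w g h. \<lbrakk>{v, w} \<in> E; g \<in> carrier (G v); h \<in> carrier (G w)\<rbrakk>
      \<Longrightarrow> f v g \<otimes>\<^bsub>H\<^esub> f w h = f w h \<otimes>\<^bsub>H\<^esub> f v g"
  obtains F where "F \<in> hom GP H"
    "\<And>v g. \<lbrakk>v \<in> V; g \<in> carrier (G v)\<rbrakk> \<Longrightarrow> F (vertex_incl v g) = f v g"
proof -
  interpret H: group H by fact
  obtain F where F: "F \<in> hom (free_product V G) H"
    "\<And>v g. \<lbrakk>v \<in> V; g \<in> carrier (G v)\<rbrakk> \<Longrightarrow> F (free_product_incl V G v g) = f v g"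
    using free_product_universal[OF assms(1) f] by blast
  interpret F: group_hom "free_product V G" H F
    using F(1) by unfold_locales
  have "edge_commutators \<subseteq> kernel (free_product V G) H F"
  proof
    fix c assume c: "c \<in> edge_commutators"
    then obtain v w g h where vw: "{v, w} \<in> E" "g \<in> carrier (G v)" "h \<in> carrier (G w)"
      "c = commutator (free_product V G) (free_product_incl V G v g) (free_product_incl V G w h)"
      by blast
    moreover have "v \<in> V" "w \<in> V"
      using vw edgeD by auto
    moreover have "f v g \<in> carrier H" "f w h \<in> carrier H"
      using f calculation by (auto simp: hom_def)
    ultimately have "F c = \<one>\<^bsub>H\<^esub>"
      using H.commutator_eq_one_iff comm
      by (simp add: F.hom_commutator free_product_incl_closed F(2))
    then show "c \<in> kernel (free_product V G) H F"
      using subsetD[OF edge_commutators_closed c] by (simp add: kernel_def)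
  qed
  then have "normal_closure (free_product V G) edge_commutators \<subseteq> kernel (free_product V G) H F"
    using F.normal_kernel unfolding normal_closure_def by blast
  from F.FactGroup_universal_kernel[OF normal_edge_closure this]
  obtain k where k: "k \<in> hom GP H"
    "\<And>x. x \<in> carrier (free_product V G) \<Longrightarrow>
      k (normal_closure (free_product V G) edge_commutators #>\<^bsub>free_product V G\<^esub> x) = F x"
    unfolding graph_product_eq by blast
  show thesis
    using k(1) by (rule that) (simp add: vertex_incl_def k(2) free_product_incl_closed F(2))
qed

text \<open>Expresses that the vertex groups generate: every element is the coset of a word class,
  and prefixing a letter to the word is left multiplication by its
  \<open>vertex_incl\<close>.\<close>

lemma graph_product_induct [consumes 1, case_names one mult]:
  assumes "p \<in> carrier GP" and one: "P \<one>\<^bsub>GP\<^esub>"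
    and mult: "\<And>v g p. \<lbrakk>v \<in> V; g \<in> carrier (G v); p \<in> carrier GP; P p\<rbrakk>
      \<Longrightarrow> P (vertex_incl v g \<otimes>\<^bsub>GP\<^esub> p)"
  shows "P p"
proof -
  define q where
    "q xs = normal_closure (free_product V G) edge_commutators #>\<^bsub>free_product V G\<^esub> word_class xs"
    for xs
  have q_closed: "q xs \<in> carrier GP" if "xs \<in> words" for xs
    using that unfolding graph_product_eq q_def carrier_FactGroup carrier_free_product by blast
  have "P (q xs)" if "xs \<in> words" for xs
    using that
  proof (induction rule: words_induct)
    case Nil
    have "q [] = \<one>\<^bsub>GP\<^esub>"
      unfolding graph_product_eq q_def one_free_product[symmetric] by (simp add: N.subset)
    then show ?case using one by simp
  next
    case (Cons v g xs)
    have "word_class ((v, g) # xs) = free_product_incl V G v g \<otimes>\<^bsub>free_product V G\<^esub> word_class xs"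
      using Cons mult_free_product[of "[(v, g)]" xs] by (simp add: free_product_incl_def)
    moreover have "word_class xs \<in> carrier (free_product V G)"
      using Cons by (simp add: carrier_free_product)
    ultimately have "q ((v, g) # xs) = vertex_incl v g \<otimes>\<^bsub>GP\<^esub> q xs"
      using Cons free_product_incl_closed
      unfolding graph_product_eq q_def vertex_incl_def by (simp add: N.rcos_sum)
    then show ?case
      using Cons mult q_closed by simp
  qed
  moreover have "\<exists>xs\<in>words. p = q xs"
    using assms(1) unfolding graph_product_eq q_def carrier_FactGroup carrier_free_product by blast
  ultimately show ?thesis by blast
qed

text \<open>The uniqueness half of the universal property; later it reduces identities between
  endomorphisms to a check on generators.\<close>

lemma graph_product_hom_eqI:
  assumes "group H" "F \<in> hom GP H" "F' \<in> hom GP H"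
    and "\<And>v g. \<lbrakk>v \<in> V; g \<in> carrier (G v)\<rbrakk> \<Longrightarrow> F (vertex_incl v g) = F' (vertex_incl v g)"
    and "p \<in> carrier GP"
  shows "F p = F' p"
  using \<open>p \<in> carrier GP\<close>
proof (induction rule: graph_product_induct)
  case one
  then show ?case
    using hom_one assms(1-3) GP.is_group by metis
next
  case (mult v g p)
  then show ?case
    using assms by (simp add: hom_mult)
qed

end

section \<open>Partial conjugations\<close>

text \<open>Since \<open>f\<close> moves elements only within their cosets of the derived subgroup,
  it induces the identity on the abelianization. The restriction is taken because elements of
  \<open>AutoGroup\<close> are extensional functions.\<close>

lemma (in group) restrict_mem_IA:
  assumes f: "f \<in> hom G G" and bij: "bij_betw f (carrier G) (carrier G)"
    and D: "\<And>x. x \<in> carrier G \<Longrightarrow> f x \<in> derived G (carrier G) #> x"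
  shows "restrict f (carrier G) \<in> IA G"
proof -
  let ?D = "derived G (carrier G)" and ?f = "restrict f (carrier G)"
  have sg: "subgroup ?D G"
    by (rule derived_is_subgroup) simp
  have "?f \<in> hom G G"
    using f by (auto simp: hom_def)
  moreover have "?f \<in> Bij (carrier G)"
    using bij by (simp add: Bij_def cong: bij_betw_cong)
  moreover have "?f ` C = C" if C: "C \<in> carrier (abelianization G)" for C
  proof -
    obtain x where x: "x \<in> carrier G" "C = ?D #> x"
      using C by (auto simp: abelianization_def carrier_FactGroup)
    have Ccl: "C \<subseteq> carrier G"
      using x sg by (simp add: r_coset_subset_G subgroup.subset)
    have fD: "?D #> f c = ?D #> c" if "c \<in> carrier G" for c
      using repr_independence[OF D[OF that] that sg] by simp
    have C_iff: "c \<in> C \<longleftrightarrow> ?D #> c = C" if "c \<in> carrier G" for c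
      using x repr_independence[OF _ x(1) sg] rcos_self[OF that sg] by auto
    \<comment> \<open>Both directions matter: a preimage of an element of \<open>C\<close>, which
      exists by surjectivity, must itself lie in \<open>C\<close>.\<close>
    have f_C_iff: "f c \<in> C \<longleftrightarrow> c \<in> C" if "c \<in> carrier G" for c
      using C_iff[OF that] C_iff[OF hom_in_carrier[OF f that]] fD[OF that] by simp
    have "?f ` C = f ` C"
      using Ccl by (intro image_cong) auto
    also have "\<dots> = C"
    proof
      show "f ` C \<subseteq> C"
        using Ccl f_C_iff by blast
      show "C \<subseteq> f ` C"
      proof
        fix c assume c: "c \<in> C"
        then have "c \<in> f ` carrier G"
          using Ccl bij_betw_imp_surj_on[OF bij] by blast
        then obtain b where "b \<in> carrier G" "c = f b"
          by (rule imageE)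
        then show "c \<in> f ` C"
          using c f_C_iff by simp
      qed
    qed
    finally show ?thesis .
  qed
  then have "abelianization_map G ?f = (\<lambda>C\<in>carrier (abelianization G). C)"
    unfolding abelianization_map_def by (intro restrict_ext)
  ultimately show ?thesis
    by (simp add: IA_def kernel_def AutoGroup_def auto_def BijGroup_def)
qed

section \<open>Partial conjugations by an element of a vertex group\<close>

context graph_of_groups
begin

text \<open>
  The condition on \<open>A\<close> makes conjugation of the vertex groups over \<open>A\<close> by an element of the
  vertex group at \<open>v\<close> compatible with the commutation relations.
\<close>

definition conjugable :: "'v \<Rightarrow> 'v set \<Rightarrow> bool" where
  "conjugable v A \<longleftrightarrow> (\<forall>w u. {w, u} \<in> E \<longrightarrow> w \<in> A \<longrightarrow> u \<notin> A \<longrightarrow> {v, u} \<in> E)"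

text \<open>By the universal property only the edge relations need checking. If both ends lie in
  \<open>A\<close>, the whole relation is conjugated; if exactly one does, the other end is adjacent
  to \<open>v\<close> and so commutes with the conjugating element as well.\<close>

lemma partial_conjugation:
  assumes v: "v \<in> V" and g: "g \<in> carrier (G v)" and A: "conjugable v A"
  obtains f where "f \<in> hom GP GP"
    "\<And>w h. \<lbrakk>w \<in> V; h \<in> carrier (G w)\<rbrakk> \<Longrightarrow> f (vertex_incl w h) =
      (if w \<in> A then vertex_incl v g \<otimes>\<^bsub>GP\<^esub> vertex_incl w h \<otimes>\<^bsub>GP\<^esub> inv\<^bsub>GP\<^esub> vertex_incl v g
       else vertex_incl w h)"
proof -
  let ?f = "\<lambda>w h. if w \<in> A
    then vertex_incl v g \<otimes>\<^bsub>GP\<^esub> vertex_incl w h \<otimes>\<^bsub>GP\<^esub> inv\<^bsub>GP\<^esub> vertex_incl v g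
    else vertex_incl w h"
  let ?c = "vertex_incl v g"
  have c: "?c \<in> carrier GP"
    using v g by simp
  have conj_mult: "?c \<otimes>\<^bsub>GP\<^esub> (x \<otimes>\<^bsub>GP\<^esub> y) \<otimes>\<^bsub>GP\<^esub> inv\<^bsub>GP\<^esub> ?c =
      ?c \<otimes>\<^bsub>GP\<^esub> x \<otimes>\<^bsub>GP\<^esub> inv\<^bsub>GP\<^esub> ?c \<otimes>\<^bsub>GP\<^esub> (?c \<otimes>\<^bsub>GP\<^esub> y \<otimes>\<^bsub>GP\<^esub> inv\<^bsub>GP\<^esub> ?c)"
    if "x \<in> carrier GP" "y \<in> carrier GP" for x y
    using c that by (simp add: GP.m_assoc GP.cancel_left)
  have hom: "?f w \<in> hom (G w) GP" if "w \<in> V" for w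
    using that c by (auto intro!: homI simp: hom_mult[OF vertex_incl_hom] conj_mult)
  \<comment> \<open>The case of a single end in \<open>A\<close>: conjugation by \<open>?c\<close>
    fixes \<open>y\<close>, so conjugating \<open>x y = y x\<close> gives the claim.\<close>
  have conj_comm: "?c \<otimes>\<^bsub>GP\<^esub> x \<otimes>\<^bsub>GP\<^esub> inv\<^bsub>GP\<^esub> ?c \<otimes>\<^bsub>GP\<^esub> y = y \<otimes>\<^bsub>GP\<^esub> (?c \<otimes>\<^bsub>GP\<^esub> x \<otimes>\<^bsub>GP\<^esub> inv\<^bsub>GP\<^esub> ?c)"
    if "x \<in> carrier GP" "y \<in> carrier GP" "x \<otimes>\<^bsub>GP\<^esub> y = y \<otimes>\<^bsub>GP\<^esub> x" "?c \<otimes>\<^bsub>GP\<^esub> y = y \<otimes>\<^bsub>GP\<^esub> ?c" for x y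
  proof -
    have "?c \<otimes>\<^bsub>GP\<^esub> y \<otimes>\<^bsub>GP\<^esub> inv\<^bsub>GP\<^esub> ?c = y"
      by (rule GP.conj_eq_iff_commute[THEN iffD2, OF c that(2,4)])
    then show ?thesis
      using conj_mult[of x y] conj_mult[of y x] that by simp
  qed
  have comm: "?f w h \<otimes>\<^bsub>GP\<^esub> ?f u k = ?f u k \<otimes>\<^bsub>GP\<^esub> ?f w h"
    if e: "{w, u} \<in> E" "h \<in> carrier (G w)" "k \<in> carrier (G u)" for w u h k
  proof -
    note cl = e edgeD[OF e(1)] 
    have wu: "vertex_incl w h \<otimes>\<^bsub>GP\<^esub> vertex_incl u k = vertex_incl u k \<otimes>\<^bsub>GP\<^esub> vertex_incl w h"
      using vertex_incl_commute e by blast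
    have wl: "vertex_incl w h \<in> carrier GP" "vertex_incl u k \<in> carrier GP"
      using cl by simp_all
    show ?thesis
    proof (cases "w \<in> A"; cases "u \<in> A")
      assume "w \<in> A" "u \<in> A"
      then show ?thesis
        using conj_mult[OF wl] conj_mult[OF wl(2,1)] wu by simp
    next
      assume wA: "w \<in> A" "u \<notin> A"
      then have "{v, u} \<in> E"
        using A e unfolding conjugable_def by blast
      then show ?thesis
        using wA conj_comm[OF wl wu vertex_incl_commute[OF _ g e(3)]] by simp
    next
      assume wA: "w \<notin> A" "u \<in> A"
      then have "{v, w} \<in> E"
        using A e unfolding conjugable_def by (metis insert_commute)
      then show ?thesis
        using wA conj_comm[OF wl(2,1) wu[symmetric] vertex_incl_commute[OF _ g e(2)]] by simp
    qed (simp add: wu)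
  qed
  show thesis
    using graph_product_universal[OF GP.is_group hom comm] that by blast
qed

text \<open>Both maps fix the conjugating element, whether or not \<open>v\<close> lies in
  \<open>A\<close>, because it commutes with itself. The two conjugations therefore cancel on each
  generator.\<close>

lemma partial_conjugation_inverse:
  assumes v: "v \<in> V" and g: "g \<in> carrier (G v)"
    and f: "f \<in> hom GP GP"
    "\<And>w h. \<lbrakk>w \<in> V; h \<in> carrier (G w)\<rbrakk> \<Longrightarrow> f (vertex_incl w h) =
      (if w \<in> A then vertex_incl v g \<otimes>\<^bsub>GP\<^esub> vertex_incl w h \<otimes>\<^bsub>GP\<^esub> inv\<^bsub>GP\<^esub> vertex_incl v g
       else vertex_incl w h)"
    and f': "f' \<in> hom GP GP"
    "\<And>w h. \<lbrakk>w \<in> V; h \<in> carrier (G w)\<rbrakk> \<Longrightarrow> f' (vertex_incl w h) =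
      (if w \<in> A then inv\<^bsub>GP\<^esub> vertex_incl v g \<otimes>\<^bsub>GP\<^esub> vertex_incl w h \<otimes>\<^bsub>GP\<^esub> vertex_incl v g
       else vertex_incl w h)"
    and x: "x \<in> carrier GP"
  shows "f (f' x) = x" "f' (f x) = x"
proof -
  let ?c = "vertex_incl v g"
  have c: "?c \<in> carrier GP"
    using v g by simp
  interpret f: group_hom GP GP f
    using f(1) by unfold_locales
  interpret f': group_hom GP GP f'
    using f'(1) by unfold_locales
  have fc: "f ?c = ?c" "f' ?c = ?c"
    using f(2)[OF v g] f'(2)[OF v g] c by (simp_all add: GP.m_assoc)
  have "(f \<circ> f') x = id x"
  proof (rule graph_product_hom_eqI[OF GP.is_group _ _ _ x])
    show "f \<circ> f' \<in> hom GP GP"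
      by (rule hom_compose[OF f'(1) f(1)])
    show "(f \<circ> f') (vertex_incl w h) = id (vertex_incl w h)"
      if "w \<in> V" "h \<in> carrier (G w)" for w h
      using that fc c by (simp add: f f' GP.m_assoc GP.cancel_left)
  qed (auto intro: homI)
  then show "f (f' x) = x" by simp
  have "(f' \<circ> f) x = id x"
  proof (rule graph_product_hom_eqI[OF GP.is_group _ _ _ x])
    show "f' \<circ> f \<in> hom GP GP"
      by (rule hom_compose[OF f(1) f'(1)])
    show "(f' \<circ> f) (vertex_incl w h) = id (vertex_incl w h)"
      if "w \<in> V" "h \<in> carrier (G w)" for w h
      using that fc c by (simp add: f f' GP.m_assoc GP.cancel_left)
  qed (auto intro: homI)
  then show "f' (f x) = x" by simp
qed

text \<open>A partial conjugation changes generators only by commutators, so it lies in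
  \<open>IA\<close> and is conjugation by some \<open>x\<close>. Off \<open>A\<close> it is the
  identity, so \<open>x\<close> centralizes; on \<open>A\<close> conjugation by \<open>x\<close> and
  by the vertex element agree, so their quotient centralizes.\<close>

lemma partial_conjugation_inner:
  assumes semi: "semicomplete GP"
    and v: "v \<in> V" and g: "g \<in> carrier (G v)" and A: "conjugable v A"
  obtains x where "x \<in> carrier GP"
    "\<And>w h. \<lbrakk>w \<in> V - A; h \<in> carrier (G w)\<rbrakk> \<Longrightarrow>
      x \<otimes>\<^bsub>GP\<^esub> vertex_incl w h = vertex_incl w h \<otimes>\<^bsub>GP\<^esub> x"
    "\<And>w h. \<lbrakk>w \<in> V \<inter> A; h \<in> carrier (G w)\<rbrakk> \<Longrightarrow>
      (inv\<^bsub>GP\<^esub> x \<otimes>\<^bsub>GP\<^esub> vertex_incl v g) \<otimes>\<^bsub>GP\<^esub> vertex_incl w h =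
      vertex_incl w h \<otimes>\<^bsub>GP\<^esub> (inv\<^bsub>GP\<^esub> x \<otimes>\<^bsub>GP\<^esub> vertex_incl v g)"
proof -
  let ?c = "vertex_incl v g" and ?D = "derived GP (carrier GP)"
  have c: "?c \<in> carrier GP"
    using v g by simp
  interpret Gv: group "G v"
    using v group_vertex by blast
  obtain f where f: "f \<in> hom GP GP"
    "\<And>w h. \<lbrakk>w \<in> V; h \<in> carrier (G w)\<rbrakk> \<Longrightarrow> f (vertex_incl w h) =
      (if w \<in> A then ?c \<otimes>\<^bsub>GP\<^esub> vertex_incl w h \<otimes>\<^bsub>GP\<^esub> inv\<^bsub>GP\<^esub> ?c else vertex_incl w h)"
    using partial_conjugation[OF v g A] by blast
  \<comment> \<open>The inverse automorphism is the partial conjugation by the inverse of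
    \<open>g\<close>.\<close>
  obtain f' where f': "f' \<in> hom GP GP"
    "\<And>w h. \<lbrakk>w \<in> V; h \<in> carrier (G w)\<rbrakk> \<Longrightarrow> f' (vertex_incl w h) =
      (if w \<in> A then inv\<^bsub>GP\<^esub> ?c \<otimes>\<^bsub>GP\<^esub> vertex_incl w h \<otimes>\<^bsub>GP\<^esub> ?c else vertex_incl w h)"
    using partial_conjugation[OF v Gv.inv_closed[OF g] A] unfolding vertex_incl_inv[OF v g] GP.inv_inv[OF c]
    by blast
  note inverse = partial_conjugation_inverse[OF v g f f']
  interpret f: group_hom GP GP f
    using f(1) by unfold_locales
  interpret D: normal ?D GP
    by (rule GP.derived_self_is_normal)
  have bij: "bij_betw f (carrier GP) (carrier GP)"
    using f(1) f'(1) inverse by (intro bij_betwI[where g = f']) (auto simp: hom_def)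
  have "f x \<in> ?D #>\<^bsub>GP\<^esub> x" if x: "x \<in> carrier GP" for x
  proof -
    let ?q = "\<lambda>a. ?D #>\<^bsub>GP\<^esub> a"
    \<comment> \<open>Both sides are homomorphisms into the abelianization, so comparing them on
      generators suffices.\<close>
    have "(?q \<circ> f) x = ?q x"
    proof (rule graph_product_hom_eqI[OF D.factorgroup_is_group _ D.r_coset_hom_Mod _ x])
      show "?q \<circ> f \<in> hom GP (GP Mod ?D)"
        by (rule hom_compose[OF f(1) D.r_coset_hom_Mod])
      show "(?q \<circ> f) (vertex_incl w h) = ?q (vertex_incl w h)"
        if "w \<in> V" "h \<in> carrier (G w)" for w h
      proof -
        have "?c \<otimes>\<^bsub>GP\<^esub> vertex_incl w h \<otimes>\<^bsub>GP\<^esub> inv\<^bsub>GP\<^esub> ?c =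
            commutator GP ?c (vertex_incl w h) \<otimes>\<^bsub>GP\<^esub> vertex_incl w h"
          using that c by (simp add: commutator_def GP.m_assoc)
        moreover have "commutator GP ?c (vertex_incl w h) \<in> ?D"
          unfolding derived_def commutator_def using that c vertex_incl_closed by (intro generate.incl) blast
        ultimately have "?q (?c \<otimes>\<^bsub>GP\<^esub> vertex_incl w h \<otimes>\<^bsub>GP\<^esub> inv\<^bsub>GP\<^esub> ?c) = ?q (vertex_incl w h)"
          using that GP.repr_independence[OF _ _ D.is_subgroup] GP.rcosI[OF _ D.subset]
          by (metis vertex_incl_closed)
        then show ?thesis
          using that by (simp add: f(2))
      qed
    qed
    then show ?thesis
      using x GP.rcos_self[OF _ D.is_subgroup, of "f x"] by simp
  qed
  with f(1) bij have "restrict f (carrier GP) \<in> IA GP"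
    by (rule GP.restrict_mem_IA)
  then obtain x where x: "x \<in> carrier GP"
    and eq: "restrict f (carrier GP) = (\<lambda>y\<in>carrier GP. x \<otimes>\<^bsub>GP\<^esub> y \<otimes>\<^bsub>GP\<^esub> inv\<^bsub>GP\<^esub> x)"
    using semi by (auto simp: semicomplete_def Inn_def)
  have fx: "f y = x \<otimes>\<^bsub>GP\<^esub> y \<otimes>\<^bsub>GP\<^esub> inv\<^bsub>GP\<^esub> x" if "y \<in> carrier GP" for y
    using fun_cong[OF eq, of y] that by simp
  show thesis
  proof
    show "x \<in> carrier GP" by fact
    show "x \<otimes>\<^bsub>GP\<^esub> vertex_incl w h = vertex_incl w h \<otimes>\<^bsub>GP\<^esub> x"
      if "w \<in> V - A" "h \<in> carrier (G w)" for w h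
      using that fx[of "vertex_incl w h"] f(2)[of w h] x
        GP.conj_eq_iff_commute[of x "vertex_incl w h"] by simp
    show "(inv\<^bsub>GP\<^esub> x \<otimes>\<^bsub>GP\<^esub> ?c) \<otimes>\<^bsub>GP\<^esub> vertex_incl w h =
        vertex_incl w h \<otimes>\<^bsub>GP\<^esub> (inv\<^bsub>GP\<^esub> x \<otimes>\<^bsub>GP\<^esub> ?c)"
      if "w \<in> V \<inter> A" "h \<in> carrier (G w)" for w h
    proof -
      let ?y = "vertex_incl w h"
      have y: "?y \<in> carrier GP"
        using that by simp
      have "x \<otimes>\<^bsub>GP\<^esub> ?y \<otimes>\<^bsub>GP\<^esub> inv\<^bsub>GP\<^esub> x = ?c \<otimes>\<^bsub>GP\<^esub> ?y \<otimes>\<^bsub>GP\<^esub> inv\<^bsub>GP\<^esub> ?c"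
        using that fx[OF y] f(2)[of w h] by simp
      then have "inv\<^bsub>GP\<^esub> x \<otimes>\<^bsub>GP\<^esub> (x \<otimes>\<^bsub>GP\<^esub> ?y \<otimes>\<^bsub>GP\<^esub> inv\<^bsub>GP\<^esub> x) \<otimes>\<^bsub>GP\<^esub> ?c =
          inv\<^bsub>GP\<^esub> x \<otimes>\<^bsub>GP\<^esub> (?c \<otimes>\<^bsub>GP\<^esub> ?y \<otimes>\<^bsub>GP\<^esub> inv\<^bsub>GP\<^esub> ?c) \<otimes>\<^bsub>GP\<^esub> ?c"
        by simp
      then show ?thesis
        using x y c by (simp add: GP.m_assoc GP.cancel_left)
    qed
  qed
qed

end

section \<open>Reduced words\<close>

lemma mult_BijGroup_apply:
  "\<lbrakk>f \<in> carrier (BijGroup S); g \<in> carrier (BijGroup S); x \<in> S\<rbrakk>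
    \<Longrightarrow> (f \<otimes>\<^bsub>BijGroup S\<^esub> g) x = f (g x)"
  by (simp add: BijGroup_def compose_def)

lemma BijGroup_eqI:
  assumes "f \<in> carrier (BijGroup S)" "g \<in> carrier (BijGroup S)" "\<And>x. x \<in> S \<Longrightarrow> f x = g x"
  shows "f = g"
  using assms by (auto simp: BijGroup_def Bij_def intro: extensionalityI)

section \<open>Van der Waerden's action of the groups on reduced words\<close>

context group_family
begin

definition starts :: "'v \<Rightarrow> ('v \<times> 'g) list \<Rightarrow> bool" where
  "starts v w \<longleftrightarrow> w \<noteq> [] \<and> fst (hd w) = v"

definition reduced_words :: "('v \<times> 'g) list set" where
  "reduced_words =
    {w \<in> words. (\<forall>l\<in>set w. snd l \<noteq> \<one>\<^bsub>G (fst l)\<^esub>) \<and> successively (\<lambda>l m. fst l \<noteq> fst m) w}"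

text \<open>Admitting the identity for \<open>g\<close> lets every reduced word be written as
  \<open>prefix_letter v g u\<close> with \<open>u\<close> not starting at \<open>v\<close>, without
  a separate case for words that do not start at \<open>v\<close>.\<close>

definition prefix_letter :: "'v \<Rightarrow> 'g \<Rightarrow> ('v \<times> 'g) list \<Rightarrow> ('v \<times> 'g) list" where
  "prefix_letter v g w = (if g = \<one>\<^bsub>G v\<^esub> then w else (v, g) # w)"

text \<open>Left multiplication by \<open>g\<close>, carried out on normal forms.\<close>

definition act :: "'v \<Rightarrow> 'g \<Rightarrow> ('v \<times> 'g) list \<Rightarrow> ('v \<times> 'g) list" where
  "act v g w =
    (if starts v w then prefix_letter v (g \<otimes>\<^bsub>G v\<^esub> snd (hd w)) (tl w) else prefix_letter v g w)"

definition letter_perm :: "'v \<Rightarrow> 'g \<Rightarrow> ('v \<times> 'g) list \<Rightarrow> ('v \<times> 'g) list" where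
  "letter_perm v g = restrict (act v g) reduced_words"

abbreviation "perms \<equiv> BijGroup reduced_words"

abbreviation "word_perm \<equiv> word_eval perms letter_perm"

sublocale perms: group "BijGroup reduced_words"
  by (rule group_BijGroup)

lemma reduced_words_Nil [simp]: "[] \<in> reduced_words"
  by (simp add: reduced_words_def)

lemma starts_simps [simp]: "\<not> starts v []" "starts v (l # w) \<longleftrightarrow> fst l = v"
  by (auto simp: starts_def)

lemma reduced_words_Cons [simp]:
  "(v, g) # w \<in> reduced_words \<longleftrightarrow>
    v \<in> V \<and> g \<in> carrier (G v) \<and> g \<noteq> \<one>\<^bsub>G v\<^esub> \<and> w \<in> reduced_words \<and> \<not> starts v w"
  by (cases w) (auto simp: reduced_words_def)

lemma reduced_words_snoc:
  "w @ [(v, g)] \<in> reduced_words \<longleftrightarrow>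
    v \<in> V \<and> g \<in> carrier (G v) \<and> g \<noteq> \<one>\<^bsub>G v\<^esub> \<and> w \<in> reduced_words \<and> (w = [] \<or> fst (last w) \<noteq> v)"
  by (auto simp: reduced_words_def successively_append_iff)

lemma prefix_letter_reduced:
  "\<lbrakk>v \<in> V; g \<in> carrier (G v); w \<in> reduced_words; \<not> starts v w\<rbrakk>
    \<Longrightarrow> prefix_letter v g w \<in> reduced_words"
  by (simp add: prefix_letter_def)

lemma reduced_words_cases:
  assumes "w \<in> reduced_words" "v \<in> V"
  obtains g u where "g \<in> carrier (G v)" "u \<in> reduced_words" "\<not> starts v u"
    "w = prefix_letter v g u"
proof (cases "starts v w")
  case True
  then obtain g u where "w = (v, g) # u"
    by (cases w) auto
  then show ?thesis
    using assms that[of g u] by (simp add: prefix_letter_def)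
next
  case False
  interpret group "G v"
    using assms group_vertex by blast
  show ?thesis
    using False assms that[of "\<one>\<^bsub>G v\<^esub>" w] by (simp add: prefix_letter_def)
qed

text \<open>In this decomposition the action is left translation of the component at
  \<open>v\<close>; closure and the action laws below thus reduce to the group axioms of
  \<open>G v\<close>.\<close>

lemma act_prefix_letter:
  assumes "v \<in> V" "g \<in> carrier (G v)" "h \<in> carrier (G v)" "\<not> starts v w"
  shows "act v g (prefix_letter v h w) = prefix_letter v (g \<otimes>\<^bsub>G v\<^esub> h) w"
proof -
  interpret group "G v"
    using assms group_vertex by blast
  show ?thesis
    using assms by (simp add: act_def prefix_letter_def)
qed

lemma act_closed:
  assumes "v \<in> V" "g \<in> carrier (G v)" "w \<in> reduced_words"
  shows "act v g w \<in> reduced_words"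
proof -
  interpret group "G v"
    using assms group_vertex by blast
  obtain h u where "h \<in> carrier (G v)" "u \<in> reduced_words" "\<not> starts v u" "w = prefix_letter v h u"
    using reduced_words_cases assms by blast
  then show ?thesis
    using assms by (simp add: act_prefix_letter prefix_letter_reduced)
qed

lemma act_mult:
  assumes "v \<in> V" "g \<in> carrier (G v)" "h \<in> carrier (G v)" "w \<in> reduced_words"
  shows "act v g (act v h w) = act v (g \<otimes>\<^bsub>G v\<^esub> h) w"
proof -
  interpret group "G v"
    using assms group_vertex by blast
  obtain k u where "k \<in> carrier (G v)" "u \<in> reduced_words" "\<not> starts v u" "w = prefix_letter v k u"
    using reduced_words_cases assms by blast
  then show ?thesis
    using assms by (simp add: act_prefix_letter m_assoc)
qed

lemma act_one:
  assumes "v \<in> V" "w \<in> reduced_words"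
  shows "act v \<one>\<^bsub>G v\<^esub> w = w"
proof -
  interpret group "G v"
    using assms group_vertex by blast
  obtain k u where "k \<in> carrier (G v)" "u \<in> reduced_words" "\<not> starts v u" "w = prefix_letter v k u"
    using reduced_words_cases assms by blast
  then show ?thesis
    using assms by (simp add: act_prefix_letter)
qed

lemma letter_perm_apply: "w \<in> reduced_words \<Longrightarrow> letter_perm v g w = act v g w"
  by (simp add: letter_perm_def)

lemma letter_perm_apply_Nil: "letter_perm v g [] = prefix_letter v g []"
  by (simp add: letter_perm_apply act_def)

lemma letter_perm_closed:
  assumes "v \<in> V" "g \<in> carrier (G v)"
  shows "letter_perm v g \<in> carrier perms"
proof -
  interpret group "G v"
    using assms group_vertex by blast
  have "bij_betw (letter_perm v g) reduced_words reduced_words"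
    by (rule bij_betwI[where g = "letter_perm v (inv\<^bsub>G v\<^esub> g)"])
      (use assms in \<open>auto simp: letter_perm_apply act_closed act_mult act_one\<close>)
  then show ?thesis
    by (simp add: BijGroup_def Bij_def letter_perm_def)
qed

lemma letter_perm_mult:
  assumes "v \<in> V" "g \<in> carrier (G v)" "h \<in> carrier (G v)"
  shows "letter_perm v (g \<otimes>\<^bsub>G v\<^esub> h) = letter_perm v g \<otimes>\<^bsub>perms\<^esub> letter_perm v h"
proof -
  interpret group "G v"
    using assms group_vertex by blast
  show ?thesis
    using assms
    by (intro BijGroup_eqI[of _ reduced_words])
      (simp_all add: letter_perm_closed mult_BijGroup_apply letter_perm_apply act_closed act_mult)
qed

lemma letter_perm_hom: "v \<in> V \<Longrightarrow> letter_perm v \<in> hom (G v) perms"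
  by (simp add: homI letter_perm_closed letter_perm_mult)

lemma letter_perm_one: "v \<in> V \<Longrightarrow> letter_perm v \<one>\<^bsub>G v\<^esub> = \<one>\<^bsub>perms\<^esub>"
  using hom_one[OF letter_perm_hom] group_vertex perms.is_group by blast

text \<open>The value at the empty word recovers the group element.\<close>

lemma letter_perm_inj:
  assumes "v \<in> V"
  shows "inj_on (letter_perm v) (carrier (G v))"
proof
  fix g h assume "letter_perm v g = letter_perm v h"
  then have "prefix_letter v g [] = prefix_letter v h []"
    by (metis letter_perm_apply_Nil)
  then show "g = h"
    by (auto simp: prefix_letter_def split: if_splits)
qed

lemma letter_perm_eq_letter_perm:
  assumes "v \<noteq> u" "letter_perm v g = letter_perm u h"
  shows "g = \<one>\<^bsub>G v\<^esub>"
proof -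
  have "prefix_letter v g [] = prefix_letter u h []"
    using assms by (metis letter_perm_apply_Nil)
  then show ?thesis
    using assms(1) by (auto simp: prefix_letter_def split: if_splits)
qed

section \<open>Normal forms and centralizers in the free product\<close>

lemma reduced_words_induct [consumes 1, case_names Nil Cons]:
  assumes "w \<in> reduced_words" "P []"
    and "\<And>v g w. \<lbrakk>v \<in> V; g \<in> carrier (G v); g \<noteq> \<one>\<^bsub>G v\<^esub>; w \<in> reduced_words; \<not> starts v w; P w\<rbrakk>
      \<Longrightarrow> P ((v, g) # w)"
  shows "P w"
  using assms(1) by (induction w) (use assms(2,3) in auto)

lemma word_perm_closed: "w \<in> reduced_words \<Longrightarrow> word_perm w \<in> carrier perms"
  by (induction rule: reduced_words_induct) (auto simp: letter_perm_closed)

text \<open>No cancellation occurs while the letters of \<open>w\<close> are applied from right to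
  left. For empty \<open>u\<close> this recovers \<open>w\<close> from its permutation, which is the
  uniqueness of normal forms.\<close>

lemma word_perm_apply:
  assumes "w \<in> reduced_words" "w @ u \<in> reduced_words"
  shows "word_perm w u = w @ u"
  using assms
proof (induction rule: reduced_words_induct)
  case Nil
  then show ?case by (simp add: BijGroup_def)
next
  case (Cons v g w)
  have "u \<in> reduced_words"
    using Cons.prems by (simp add: reduced_words_def successively_append_iff flip: append_Cons)
  then show ?case
    using Cons letter_perm_closed word_perm_closed
    by (simp add: mult_BijGroup_apply letter_perm_apply act_def prefix_letter_def)
qed

text \<open>Shows that the permutations given by reduced words are closed under left multiplication
  by letters, so that they exhaust the image of the free product.\<close>

lemma word_perm_act:
  assumes "v \<in> V" "g \<in> carrier (G v)" "w \<in> reduced_words"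
  shows "letter_perm v g \<otimes>\<^bsub>perms\<^esub> word_perm w = word_perm (act v g w)"
proof -
  interpret group "G v"
    using assms group_vertex by blast
  obtain h u where u: "h \<in> carrier (G v)" "u \<in> reduced_words" "\<not> starts v u"
      "w = prefix_letter v h u"
    using reduced_words_cases assms by blast
  have pl: "word_perm (prefix_letter v k u) = letter_perm v k \<otimes>\<^bsub>perms\<^esub> word_perm u"
    if "k \<in> carrier (G v)" for k
    using assms u by (simp add: prefix_letter_def letter_perm_one word_perm_closed)
  show ?thesis
    using assms u
    by (simp add: pl act_prefix_letter letter_perm_mult perms.m_assoc letter_perm_closed word_perm_closed)
qed

text \<open>\<open>word_eval\<close> recurses from the front, whereas the centralizer argument
  splits off the last letter.\<close>

lemma word_perm_snoc:
  assumes "w @ [(v, c)] \<in> reduced_words"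
  shows "word_perm (w @ [(v, c)]) = word_perm w \<otimes>\<^bsub>perms\<^esub> letter_perm v c"
  using assms
proof (induction w)
  case Nil
  then show ?case by (simp add: letter_perm_closed)
next
  case (Cons l w)
  obtain u g where l: "l = (u, g)" by fastforce
  have "w \<in> reduced_words" "v \<in> V" "c \<in> carrier (G v)" "w @ [(v, c)] \<in> reduced_words"
    "u \<in> V" "g \<in> carrier (G u)"
    using Cons.prems l reduced_words_snoc by auto
  then show ?case
    using Cons.IH l by (simp add: perms.m_assoc letter_perm_closed word_perm_closed)
qed

text \<open>
  Write \<open>w = u c\<close> where \<open>u\<close> does not end in the vertex group at \<open>v\<close> and \<open>c\<close> lies in it.  Then
  \<open>u\<close> conjugates \<open>c h c\<inverse>\<close> to \<open>h\<close>, and comparing the normal forms of \<open>u (c h c\<inverse>)\<close> and \<open>h u\<close>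
  forces \<open>u\<close> to be empty.
\<close>

lemma word_perm_centralizer:
  assumes w: "w \<in> reduced_words" and v: "v \<in> V" and h: "h \<in> carrier (G v)" "h \<noteq> \<one>\<^bsub>G v\<^esub>"
    and comm: "word_perm w \<otimes>\<^bsub>perms\<^esub> letter_perm v h = letter_perm v h \<otimes>\<^bsub>perms\<^esub> word_perm w"
  shows "\<exists>c\<in>carrier (G v). word_perm w = letter_perm v c"
proof -
  interpret group "G v"
    using v group_vertex by blast
  obtain u c where u: "u \<in> reduced_words" "u = [] \<or> fst (last u) \<noteq> v" and c: "c \<in> carrier (G v)"
    and wu: "word_perm w = word_perm u \<otimes>\<^bsub>perms\<^esub> letter_perm v c"
  proof (cases "w = [] \<or> fst (last w) \<noteq> v")
    case True
    then show ?thesis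
      using that[of w "\<one>\<^bsub>G v\<^esub>"] w v by (simp add: letter_perm_one word_perm_closed)
  next
    case False
    then obtain u c where "w = u @ [(v, c)]"
      by (metis append_butlast_last_id prod.collapse)
    then show ?thesis
      using that[of u c] w by (auto simp: reduced_words_snoc word_perm_snoc)
  qed
  define k where "k = c \<otimes>\<^bsub>G v\<^esub> h \<otimes>\<^bsub>G v\<^esub> inv\<^bsub>G v\<^esub> c"
  have k: "k \<in> carrier (G v)"
    using c h by (simp add: k_def)
  \<comment> \<open>As a conjugate of \<open>h\<close>, \<open>k\<close> is non-trivial; this makes
    \<open>u\<close> followed by the letter \<open>k\<close> a reduced word.\<close>
  have "k \<noteq> \<one>\<^bsub>G v\<^esub>"
    using c h inv_solve_right'[of "\<one>\<^bsub>G v\<^esub>" "c \<otimes>\<^bsub>G v\<^esub> h" c]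
    by (simp add: k_def r_cancel_one)
  have kc: "k \<otimes>\<^bsub>G v\<^esub> c = c \<otimes>\<^bsub>G v\<^esub> h"
    using c h by (simp add: k_def m_assoc)
  have "word_perm u \<otimes>\<^bsub>perms\<^esub> letter_perm v k \<otimes>\<^bsub>perms\<^esub> letter_perm v c
      = word_perm u \<otimes>\<^bsub>perms\<^esub> letter_perm v c \<otimes>\<^bsub>perms\<^esub> letter_perm v h"
    using u v c h k kc
    by (simp add: perms.m_assoc letter_perm_closed word_perm_closed flip: letter_perm_mult)
  also have "\<dots> = letter_perm v h \<otimes>\<^bsub>perms\<^esub> word_perm u \<otimes>\<^bsub>perms\<^esub> letter_perm v c"
    using comm u v c h by (simp add: wu perms.m_assoc letter_perm_closed word_perm_closed)
  finally have "word_perm u \<otimes>\<^bsub>perms\<^esub> letter_perm v k = letter_perm v h \<otimes>\<^bsub>perms\<^esub> word_perm u"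
    using u v c h k by (simp add: letter_perm_closed word_perm_closed)
  \<comment> \<open>Evaluating at the empty word turns the equation of permutations into one of
    normal forms.\<close>
  then have "(word_perm u \<otimes>\<^bsub>perms\<^esub> letter_perm v k) [] = (letter_perm v h \<otimes>\<^bsub>perms\<^esub> word_perm u) []"
    by simp
  moreover have "u @ [(v, k)] \<in> reduced_words"
    using u v k \<open>k \<noteq> \<one>\<^bsub>G v\<^esub>\<close> by (simp add: reduced_words_snoc)
  ultimately have eq: "u @ [(v, k)] = act v h u"
    using u v c h k \<open>k \<noteq> \<one>\<^bsub>G v\<^esub>\<close>
    by (simp add: mult_BijGroup_apply letter_perm_closed word_perm_closed letter_perm_apply_Nil
        prefix_letter_def word_perm_apply letter_perm_apply)
  \<comment> \<open>If \<open>u\<close> starts at \<open>v\<close>, the right side of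
    \<open>eq\<close> is no longer than \<open>u\<close>, while the left side is longer by one
    letter. Otherwise the first letters of the two sides lie over different vertices.\<close>
  have "u = []"
  proof (rule ccontr)
    assume "u \<noteq> []"
    show False
    proof (cases "starts v u")
      case True
      then have "length (act v h u) \<le> length u"
        using \<open>u \<noteq> []\<close> by (simp add: act_def prefix_letter_def)
      then show False
        by (simp flip: eq)
    next
      case False
      then have "act v h u = (v, h) # u"
        using h by (simp add: act_def prefix_letter_def)
      then show False
        using False \<open>u \<noteq> []\<close> eq by (cases u) auto
    qed
  qed
  then show ?thesis
    using wu c v by (auto simp: letter_perm_closed)
qed

end

section \<open>Retraction onto the free product over an independent set\<close>

context graph_of_groups
begin

text \<open>
  The retraction onto the free product of the vertex groups over an independent set \<open>S\<close>,
  realised faithfully by permutations of reduced words.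
\<close>

lemma independent_retraction:
  assumes S: "S \<subseteq> V" and indep: "\<And>v w. \<lbrakk>v \<in> S; w \<in> S\<rbrakk> \<Longrightarrow> {v, w} \<notin> E"
  obtains H :: "(('v \<times> 'g) list \<Rightarrow> ('v \<times> 'g) list) monoid" and F
  where "group H" "F \<in> hom GP H"
    "\<And>v. v \<in> S \<Longrightarrow> inj_on (\<lambda>g. F (vertex_incl v g)) (carrier (G v))"
    "\<And>v u g h. \<lbrakk>v \<in> S; u \<in> S; v \<noteq> u; g \<in> carrier (G v); h \<in> carrier (G u);
        F (vertex_incl v g) = F (vertex_incl u h)\<rbrakk> \<Longrightarrow> g = \<one>\<^bsub>G v\<^esub>"
    "\<And>v h p. \<lbrakk>v \<in> S; h \<in> carrier (G v); h \<noteq> \<one>\<^bsub>G v\<^esub>; p \<in> carrier GP;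
        F p \<otimes>\<^bsub>H\<^esub> F (vertex_incl v h) = F (vertex_incl v h) \<otimes>\<^bsub>H\<^esub> F p\<rbrakk>
        \<Longrightarrow> \<exists>c\<in>carrier (G v). F p = F (vertex_incl v c)"
proof -
  interpret S: group_family S G
    using S group_vertex by (auto intro: group_family.intro)
  \<comment> \<open>Vertex groups outside \<open>S\<close> are killed. By independence each edge has
    an end outside \<open>S\<close>, so the edge relations hold trivially.\<close>
  let ?f = "\<lambda>v g. if v \<in> S then S.letter_perm v g else \<one>\<^bsub>S.perms\<^esub>"
  have f_hom: "?f v \<in> hom (G v) S.perms" if "v \<in> V" for v
    using S.letter_perm_hom[of v] by (cases "v \<in> S") (simp_all add: hom_def)
  have f_closed: "?f v g \<in> carrier S.perms" if "v \<in> V" "g \<in> carrier (G v)" for v g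
    using f_hom[OF that(1)] that(2) by (auto simp: S.letter_perm_closed)
  have comm: "?f v g \<otimes>\<^bsub>S.perms\<^esub> ?f w h = ?f w h \<otimes>\<^bsub>S.perms\<^esub> ?f v g"
    if "{v, w} \<in> E" "g \<in> carrier (G v)" "h \<in> carrier (G w)" for v w g h
    using indep[of v w] that by (auto simp: S.letter_perm_closed)
  obtain F where F: "F \<in> hom GP S.perms"
    "\<And>v g. \<lbrakk>v \<in> V; g \<in> carrier (G v)\<rbrakk> \<Longrightarrow> F (vertex_incl v g) = ?f v g"
    using graph_product_universal[OF S.perms.is_group f_hom comm] by blast
  have FS: "F (vertex_incl v g) = S.letter_perm v g" if "v \<in> S" "g \<in> carrier (G v)" for v g
    using F(2) that S by auto
  \<comment> \<open>Puts every element of the image into normal form, as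
    \<open>word_perm_centralizer\<close> requires.\<close>
  have image: "\<exists>w\<in>S.reduced_words. F p = S.word_perm w" if "p \<in> carrier GP" for p
    using that
  proof (induction rule: graph_product_induct)
    case one
    then show ?case
      using hom_one[OF F(1) GP.is_group S.perms.is_group] by (auto intro!: bexI[of _ "[]"])
  next
    case (mult v g p)
    then obtain w where w: "w \<in> S.reduced_words" "F p = S.word_perm w"
      by blast
    have eq: "F (vertex_incl v g \<otimes>\<^bsub>GP\<^esub> p) = ?f v g \<otimes>\<^bsub>S.perms\<^esub> S.word_perm w"
      using mult w by (simp add: hom_mult[OF F(1)] F(2))
    show ?case
    proof (cases "v \<in> S")
      case True
      then show ?thesis
        using eq w mult S.word_perm_act S.act_closed by auto
    next
      case False
      then show ?thesis
        using eq w by (auto simp: S.word_perm_closed)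
    qed
  qed
  show thesis
  proof (rule that[OF S.perms.is_group F(1)])
    show "inj_on (\<lambda>g. F (vertex_incl v g)) (carrier (G v))" if "v \<in> S" for v
      using S.letter_perm_inj[OF that] FS[OF that] by (simp add: inj_on_def)
    show "g = \<one>\<^bsub>G v\<^esub>"
      if "v \<in> S" "u \<in> S" "v \<noteq> u" "g \<in> carrier (G v)" "h \<in> carrier (G u)"
        "F (vertex_incl v g) = F (vertex_incl u h)" for v u g h
      using that S.letter_perm_eq_letter_perm[of v u g h] by (simp add: FS)
    show "\<exists>c\<in>carrier (G v). F p = F (vertex_incl v c)"
      if "v \<in> S" "h \<in> carrier (G v)" "h \<noteq> \<one>\<^bsub>G v\<^esub>" "p \<in> carrier GP"
        "F p \<otimes>\<^bsub>S.perms\<^esub> F (vertex_incl v h) = F (vertex_incl v h) \<otimes>\<^bsub>S.perms\<^esub> F p" for v h p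
    proof -
      obtain w where w: "w \<in> S.reduced_words" "F p = S.word_perm w"
        using image \<open>p \<in> carrier GP\<close> by blast
      then show ?thesis
        using S.word_perm_centralizer[OF w(1) that(1-3)] that FS by auto
    qed
  qed
qed

end

section \<open>Semicomplete graph products\<close>

context graph_of_groups
begin

section \<open>Separating stars\<close>

lemma not_semicomplete_of_separating_star:
  assumes nontrivial: "\<And>v. v \<in> V \<Longrightarrow> \<not> trivial_group (G v)"
    and sep: "has_separating_star V E"
  shows "\<not> semicomplete GP"
proof
  assume semi: "semicomplete GP"
  obtain v where v: "v \<in> V" and
    disc: "disconnected_graph (V - star V E v) (induced_edges E (V - star V E v))"
    using sep unfolding has_separating_star_def by blast
  define U where "U = V - star V E v"
  define joined where "joined = joined_by_path U (induced_edges E U)"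
  obtain a b where a: "a \<in> U" and b: "b \<in> U" and ab: "\<not> joined a b"
    using disc unfolding disconnected_graph_def U_def joined_def by blast
  \<comment> \<open>The connected component of \<open>a\<close> in the complement of the
    star.\<close>
  define A where "A = {w \<in> U. joined a w}"
  have U_iff: "w \<in> U \<longleftrightarrow> w \<in> V \<and> w \<noteq> v \<and> {v, w} \<notin> E" for w
    by (auto simp: U_def star_def)
  have joined_refl: "joined w w" if "w \<in> U" for w
    unfolding joined_def joined_by_path_def using that by (intro exI[of _ "[w]"]) simp
  have joined_step: "joined a u" if "joined a w" "{w, u} \<in> E" "w \<in> U" "u \<in> U" for w u
  proof -
    from that(1) obtain p where p: "p \<noteq> [] \<and> set p \<subseteq> U \<and> hd p = a \<and> last p = w \<and>
        successively (\<lambda>x y. {x, y} \<in> induced_edges E U) p"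
      unfolding joined_def joined_by_path_def by (rule exE)
    have "{w, u} \<in> induced_edges E U"
      using that by (simp add: induced_edges_def)
    then have "set (p @ [u]) \<subseteq> U" "hd (p @ [u]) = a"
      "successively (\<lambda>x y. {x, y} \<in> induced_edges E U) (p @ [u])"
      using p that(4) by (simp_all add: successively_append_iff)
    then show ?thesis
      unfolding joined_def joined_by_path_def by (intro exI[of _ "p @ [u]"]) simp
  qed
  \<comment> \<open>An edge leaving the component cannot end in \<open>U\<close>. It does not end at
    \<open>v\<close> either, since no vertex of \<open>U\<close> is adjacent to \<open>v\<close>; so
    it ends at a neighbour of \<open>v\<close>.\<close>
  have "conjugable v A"
    unfolding conjugable_def
  proof (intro allI impI)
    fix w u assume wu: "{w, u} \<in> E" "w \<in> A" "u \<notin> A"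
    then have "u \<notin> U"
      using joined_step by (auto simp: A_def)
    moreover have "u \<noteq> v"
      using wu U_iff[of w] by (auto simp: A_def insert_commute)
    ultimately show "{v, u} \<in> E"
      using U_iff edgeD(2)[OF wu(1)] by blast
  qed
  note inner = partial_conjugation_inner[OF semi v _ this]
  have nontriv: "\<exists>g\<in>carrier (G w). g \<noteq> \<one>\<^bsub>G w\<^esub>" if "w \<in> V" for w
    using nontrivial[OF that] group_vertex[OF that] group.trivial_group
    unfolding trivial_group_def by (auto dest: group.is_monoid monoid.one_closed)
  obtain g where g: "g \<in> carrier (G v)" "g \<noteq> \<one>\<^bsub>G v\<^esub>"
    using nontriv v by blast
  obtain k where k: "k \<in> carrier (G b)" "k \<noteq> \<one>\<^bsub>G b\<^esub>"
    using nontriv b U_iff by blast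
  obtain l where l: "l \<in> carrier (G a)" "l \<noteq> \<one>\<^bsub>G a\<^esub>"
    using nontriv a U_iff by blast
  have verts: "a \<in> A" "a \<in> V" "b \<in> V" "v \<notin> A" "b \<notin> A" "a \<noteq> v" "b \<noteq> v" "a \<noteq> b"
    using a b ab joined_refl U_iff by (auto simp: A_def)
  have "{a, b} \<notin> E"
    using joined_step[OF joined_refl[OF a], of b] a b ab by blast
  then have indep: "\<And>w u. \<lbrakk>w \<in> {v, a, b}; u \<in> {v, a, b}\<rbrakk> \<Longrightarrow> {w, u} \<notin> E"
    using a b U_iff edgeD(3) by (auto simp: insert_commute)
  obtain H :: "(('v \<times> 'g) list \<Rightarrow> ('v \<times> 'g) list) monoid" and F
    where H: "group H" and F: "F \<in> hom GP H"
    and inj: "\<And>w. w \<in> {v, a, b} \<Longrightarrow> inj_on (\<lambda>g. F (vertex_incl w g)) (carrier (G w))"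
    and meet: "\<And>w u g h. \<lbrakk>w \<in> {v, a, b}; u \<in> {v, a, b}; w \<noteq> u; g \<in> carrier (G w);
        h \<in> carrier (G u); F (vertex_incl w g) = F (vertex_incl u h)\<rbrakk> \<Longrightarrow> g = \<one>\<^bsub>G w\<^esub>"
    and centr: "\<And>w h p. \<lbrakk>w \<in> {v, a, b}; h \<in> carrier (G w); h \<noteq> \<one>\<^bsub>G w\<^esub>; p \<in> carrier GP;
        F p \<otimes>\<^bsub>H\<^esub> F (vertex_incl w h) = F (vertex_incl w h) \<otimes>\<^bsub>H\<^esub> F p\<rbrakk>
        \<Longrightarrow> \<exists>c\<in>carrier (G w). F p = F (vertex_incl w c)"
    using independent_retraction[of "{v, a, b}"] indep v verts by auto
  interpret F: group_hom GP H F
    using H F by (simp add: group_hom_def group_hom_axioms_def GP.is_group)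
  obtain x where x: "x \<in> carrier GP"
    and x1: "\<And>w h. \<lbrakk>w \<in> V - A; h \<in> carrier (G w)\<rbrakk> \<Longrightarrow>
      x \<otimes>\<^bsub>GP\<^esub> vertex_incl w h = vertex_incl w h \<otimes>\<^bsub>GP\<^esub> x"
    and x2: "\<And>w h. \<lbrakk>w \<in> V \<inter> A; h \<in> carrier (G w)\<rbrakk> \<Longrightarrow>
      (inv\<^bsub>GP\<^esub> x \<otimes>\<^bsub>GP\<^esub> vertex_incl v g) \<otimes>\<^bsub>GP\<^esub> vertex_incl w h =
      vertex_incl w h \<otimes>\<^bsub>GP\<^esub> (inv\<^bsub>GP\<^esub> x \<otimes>\<^bsub>GP\<^esub> vertex_incl v g)"
    using inner[OF g(1)] by blast
  have "F x \<otimes>\<^bsub>H\<^esub> F (vertex_incl w h) = F (vertex_incl w h) \<otimes>\<^bsub>H\<^esub> F x"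
    if "w \<in> V - A" "h \<in> carrier (G w)" for w h
    using arg_cong[OF x1[OF that], of F] x that by simp
  note comm = this
  \<comment> \<open>Both \<open>v\<close> and \<open>b\<close> lie outside \<open>A\<close>, so
    \<open>F x\<close> lies in two different free factors and must be trivial.\<close>
  obtain c where c: "c \<in> carrier (G v)" "F x = F (vertex_incl v c)"
    using centr[OF _ g x] comm g v verts by blast
  obtain d where d: "d \<in> carrier (G b)" "F x = F (vertex_incl b d)"
    using centr[OF _ k x] comm k verts by blast
  have "c = \<one>\<^bsub>G v\<^esub>"
    using meet[of v b c d] c d verts by simp
  then have Fx: "F x = \<one>\<^bsub>H\<^esub>"
    using c hom_one[OF vertex_incl_hom[OF v] group_vertex[OF v] GP.is_group] by simp
  \<comment> \<open>With \<open>F x\<close> trivial, the relation on \<open>A\<close> says that the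
    image of \<open>g\<close> centralizes the factor at \<open>a\<close>. It then lies in the
    factors at \<open>v\<close> and at \<open>a\<close>, contradicting \<open>g\<close> being
    non-trivial.\<close>
  have "F (vertex_incl v g) \<otimes>\<^bsub>H\<^esub> F (vertex_incl a l) = F (vertex_incl a l) \<otimes>\<^bsub>H\<^esub> F (vertex_incl v g)"
    using arg_cong[OF x2[of a l], of F] x v g l verts by (simp add: Fx)
  then obtain e where "e \<in> carrier (G a)" "F (vertex_incl v g) = F (vertex_incl a e)"
    using centr[of a l "vertex_incl v g"] l v g by auto
  then show False
    using meet[of v a g e] g verts by auto
qed

section \<open>Commutativity of the vertex groups\<close>

lemma comm_group_of_semicomplete:
  assumes nontrivial: "\<And>v. v \<in> V \<Longrightarrow> \<not> trivial_group (G v)"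
    and star: "star V E v \<noteq> V"
    and semi: "semicomplete GP"
    and v: "v \<in> V"
  shows "comm_group (G v)"
proof (rule group.group_comm_groupI[OF group_vertex[OF v]])
  interpret Gv: group "G v"
    by (rule group_vertex[OF v])
  fix g h assume g: "g \<in> carrier (G v)" and h: "h \<in> carrier (G v)"
  obtain u where u: "u \<in> V" "u \<noteq> v" "{v, u} \<notin> E"
    using star v unfolding star_def by blast
  obtain k where k: "k \<in> carrier (G u)" "k \<noteq> \<one>\<^bsub>G u\<^esub>"
    using nontrivial[OF u(1)] group_vertex[OF u(1)]
    unfolding trivial_group_def by (auto dest: group.is_monoid monoid.one_closed)
  show "g \<otimes>\<^bsub>G v\<^esub> h = h \<otimes>\<^bsub>G v\<^esub> g"
  \<comment> \<open>The centralizer property is available only for non-trivial \<open>h\<close>; for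
    the identity the claim is immediate.\<close>
  proof (cases "h = \<one>\<^bsub>G v\<^esub>")
    case False
    have "conjugable v {v}"
      by (simp add: conjugable_def)
    then obtain x where x: "x \<in> carrier GP"
      and x1: "\<And>w h. \<lbrakk>w \<in> V - {v}; h \<in> carrier (G w)\<rbrakk> \<Longrightarrow>
        x \<otimes>\<^bsub>GP\<^esub> vertex_incl w h = vertex_incl w h \<otimes>\<^bsub>GP\<^esub> x"
      and x2: "\<And>w h. \<lbrakk>w \<in> V \<inter> {v}; h \<in> carrier (G w)\<rbrakk> \<Longrightarrow>
        (inv\<^bsub>GP\<^esub> x \<otimes>\<^bsub>GP\<^esub> vertex_incl v g) \<otimes>\<^bsub>GP\<^esub> vertex_incl w h =
        vertex_incl w h \<otimes>\<^bsub>GP\<^esub> (inv\<^bsub>GP\<^esub> x \<otimes>\<^bsub>GP\<^esub> vertex_incl v g)"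
      using partial_conjugation_inner[OF semi v g] by blast
    have indep: "\<And>w z. \<lbrakk>w \<in> {v, u}; z \<in> {v, u}\<rbrakk> \<Longrightarrow> {w, z} \<notin> E"
      using u edgeD(3) by (auto simp: insert_commute)
    obtain H :: "(('v \<times> 'g) list \<Rightarrow> ('v \<times> 'g) list) monoid" and F
      where H: "group H" and F: "F \<in> hom GP H"
      and inj: "\<And>w. w \<in> {v, u} \<Longrightarrow> inj_on (\<lambda>g. F (vertex_incl w g)) (carrier (G w))"
      and meet: "\<And>w z g h. \<lbrakk>w \<in> {v, u}; z \<in> {v, u}; w \<noteq> z; g \<in> carrier (G w);
          h \<in> carrier (G z); F (vertex_incl w g) = F (vertex_incl z h)\<rbrakk> \<Longrightarrow> g = \<one>\<^bsub>G w\<^esub>"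
      and centr: "\<And>w h p. \<lbrakk>w \<in> {v, u}; h \<in> carrier (G w); h \<noteq> \<one>\<^bsub>G w\<^esub>; p \<in> carrier GP;
          F p \<otimes>\<^bsub>H\<^esub> F (vertex_incl w h) = F (vertex_incl w h) \<otimes>\<^bsub>H\<^esub> F p\<rbrakk>
          \<Longrightarrow> \<exists>c\<in>carrier (G w). F p = F (vertex_incl w c)"
      using independent_retraction[of "{v, u}"] indep v u by auto
    interpret F: group_hom GP H F
      using H F by (simp add: group_hom_def group_hom_axioms_def GP.is_group)
    have Fv: "F (vertex_incl v (y \<otimes>\<^bsub>G v\<^esub> z)) = F (vertex_incl v y) \<otimes>\<^bsub>H\<^esub> F (vertex_incl v z)"
      if "y \<in> carrier (G v)" "z \<in> carrier (G v)" for y z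
      using that v by (simp add: hom_mult[OF vertex_incl_hom[OF v]])
    \<comment> \<open>Since \<open>u\<close> lies outside \<open>{v}\<close>, \<open>x\<close>
      commutes with \<open>k\<close>, which puts \<open>F x\<close> into the factor at
      \<open>u\<close>.\<close>
    obtain c where c: "c \<in> carrier (G u)" "F x = F (vertex_incl u c)"
      using centr[OF _ k x] arg_cong[OF x1[of u k], of F] x k u by auto
    let ?y = "inv\<^bsub>GP\<^esub> x \<otimes>\<^bsub>GP\<^esub> vertex_incl v g"
    have y: "?y \<in> carrier GP"
      using x v g by simp
    have comm: "F ?y \<otimes>\<^bsub>H\<^esub> F (vertex_incl v h) = F (vertex_incl v h) \<otimes>\<^bsub>H\<^esub> F ?y"
      using arg_cong[OF x2[of v h], of F] F.hom_mult[OF y, of "vertex_incl v h"]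
        F.hom_mult[OF _ y, of "vertex_incl v h"] v h by force
    obtain d where d: "d \<in> carrier (G v)" "F ?y = F (vertex_incl v d)"
      using centr[OF _ h False y comm] by blast
    \<comment> \<open>Solving \<open>F ?y = F (vertex_incl v d)\<close> for \<open>F x\<close>
      places it in the factor at \<open>v\<close> too; the two factors meet trivially, so
      \<open>g = d\<close>.\<close>
    have "F (vertex_incl v (g \<otimes>\<^bsub>G v\<^esub> inv\<^bsub>G v\<^esub> d)) = F (vertex_incl v g) \<otimes>\<^bsub>H\<^esub> inv\<^bsub>H\<^esub> F (vertex_incl v d)"
      using Fv[of g "inv\<^bsub>G v\<^esub> d"] g d v by (simp add: vertex_incl_inv)
    also have "\<dots> = F x"
      using x v g by (simp flip: d(2) add: F.H.inv_mult_group F.H.cancel_left)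
    finally have "g \<otimes>\<^bsub>G v\<^esub> inv\<^bsub>G v\<^esub> d = \<one>\<^bsub>G v\<^esub>"
      using meet[of v u "g \<otimes>\<^bsub>G v\<^esub> inv\<^bsub>G v\<^esub> d" c] c g d u by auto
    then have "g = d"
      using g d Gv.inv_solve_right'[of "\<one>\<^bsub>G v\<^esub>" g d] by simp
    \<comment> \<open>Now \<open>comm\<close> says that the images of \<open>g\<close> and
      \<open>h\<close> commute, and injectivity on the factor at \<open>v\<close> carries this back
      to \<open>G v\<close>.\<close>
    then have "F (vertex_incl v (g \<otimes>\<^bsub>G v\<^esub> h)) = F (vertex_incl v (h \<otimes>\<^bsub>G v\<^esub> g))"
      using comm d g h by (simp add: Fv)
    then show ?thesis
      using inj_onD[OF inj[of v]] g h by simp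
  qed (use g in simp)
qed

end

theorem lemmaB:
  fixes V :: "'v set" and E :: "'v set set"
    and G :: "'v \<Rightarrow> ('g, 'm) monoid_scheme"
  assumes "simple_graph V E"
    and "V \<noteq> {}"
    and "\<And>v. v \<in> V \<Longrightarrow> group (G v)"
    and "\<And>v. v \<in> V \<Longrightarrow> \<not> trivial_group (G v)"
  shows "(has_separating_star V E \<longrightarrow> \<not> semicomplete (graph_product V E G)) \<and>
    ((\<forall>v\<in>V. star V E v \<noteq> V) \<longrightarrow> semicomplete (graph_product V E G) \<longrightarrow>
      (\<forall>v\<in>V. comm_group (G v)))"
proof -
  interpret graph_of_groups V G E
    using assms(1,3) by (intro graph_of_groups.intro group_family.intro graph_of_groups_axioms.intro)
  show ?thesis
    using not_semicomplete_of_separating_star comm_group_of_semicomplete assms(4) by blast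
qed

end
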